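(* Let $n$ be odd and let $\phi$ be an $\{\frac{n-1}{2},\frac{n+1}{2},n\}$-isometry of $\mathcal{C}_n$ fixing $\overline{0}$. If $n\equiv 1 \pmod 4$, then $\phi$ is an isometry. If $n\equiv 3 \pmod 4$ and $\phi$ is not an isometry, then there are $i,j\in\{1,\ldots,n\}$ and a $\sigma_{i,j}$-mapping $\tau$ on $\mathcal{C}_n$ such that $$\phi=\begin{cases}\tau & \text{on } E,\\ T_{\overline{1}^j}\circ\tau & \text{on } O,\end{cases}$$ where $\overline{1}^j$ is the word with $1$ in all positions except for a unique $0$ in position $j$.
   Context: $\mathcal{C}_n=\{0,1\}^n$ is the Boolean cube with Hamming distance $d$ and component-wise addition modulo $2$; $\overline{0}=(0,\ldots,0)$. The weight of a word is its number of non-zero positions; $E$ and $O$ are the sets of words of even and odd weight, respectively. $T_{\overline{a}}$ is the translation $\overline{c}\mapsto\overline{c}+\overline{a}$. A $P$-isometry is a bijection $\phi$ of $\mathcal{C}_n$ such that, for each $p\in P$, $d(\phi(x),\phi(y))=p$ whenever $d(x,y)=p$; an isometry is a bijection preserving all distances. Let $i,j\in\{1,\ldots,n\}$ (possibly equal) and let $\sigma$ be a bijection from $\{1,\ldots,n\}\setminus\{i\}$ to $\{1,\ldots,n\}\setminus\{j\}$. The corresponding $\sigma_{i,j}$-mapping on $\mathcal{C}_n$ is the map $\overline{c}=(c_1,\ldots,c_n)\mapsto(d_1,\ldots,d_n)$ where: if $c_i=0$, then $d_k=c_{\sigma^{-1}(k)}$ for $k\neq j$ and $d_j=0$; if $c_i=1$,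 then $d_k=c_{\sigma^{-1}(k)}+1$ for $k\neq j$ and $d_j=1$. "A $\sigma_{i,j}$-mapping" means one for some such bijection $\sigma$. *)

theory Defs
  imports "HOL-Analysis.Finite_Cartesian_Product" "HOL-Library.Z2"
begin

text \<open>The Boolean cube of dimension \<open>n\<close> is the type \<^typ>\<open>bit ^ 'n\<close> with
  \<open>n = CARD('n)\<close>: the positions \<open>1, \<dots>, n\<close> are the elements of \<open>'n\<close>, the zero word is
  \<^term>\<open>0 :: bit ^ 'n\<close>, and the library addition of vectors is the component-wise
  addition modulo 2.\<close>

definition weight :: "bit ^ 'n \<Rightarrow> nat" where
  "weight c = card {k. c $ k \<noteq> 0}"

definition hamming_dist :: "bit ^ 'n \<Rightarrow> bit ^ 'n \<Rightarrow> nat" where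
  "hamming_dist x y = card {k. x $ k \<noteq> y $ k}"

definition even_words :: "(bit ^ 'n) set" where
  "even_words = {c. even (weight c)}"

definition odd_words :: "(bit ^ 'n) set" where
  "odd_words = {c. odd (weight c)}"

definition translation :: "bit ^ 'n \<Rightarrow> bit ^ 'n \<Rightarrow> bit ^ 'n" where
  "translation a c = c + a"

definition P_isometry :: "nat set \<Rightarrow> (bit ^ 'n \<Rightarrow> bit ^ 'n) \<Rightarrow> bool" where
  "P_isometry P \<phi> \<longleftrightarrow> bij \<phi> \<and>
     (\<forall>p\<in>P. \<forall>x y. hamming_dist x y = p \<longrightarrow> hamming_dist (\<phi> x) (\<phi> y) = p)"

definition cube_isometry :: "(bit ^ 'n \<Rightarrow> bit ^ 'n) \<Rightarrow> bool" where
  "cube_isometry \<phi> \<longleftrightarrow> bij \<phi> \<and>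
     (\<forall>x y. hamming_dist (\<phi> x) (\<phi> y) = hamming_dist x y)"

text \<open>Only the values of \<open>\<sigma>\<close> off \<open>i\<close> matter, hence its inverse is taken relative to
  \<open>UNIV - {i}\<close>.\<close>

definition sigma_map :: "('n \<Rightarrow> 'n) \<Rightarrow> 'n \<Rightarrow> 'n \<Rightarrow> bit ^ 'n \<Rightarrow> bit ^ 'n" where
  "sigma_map \<sigma> i j c =
     (if c $ i = 0
      then (\<chi> k. if k = j then 0 else c $ inv_into (UNIV - {i}) \<sigma> k)
      else (\<chi> k. if k = j then 1 else c $ inv_into (UNIV - {i}) \<sigma> k + 1))"

definition is_sigma_mapping :: "'n \<Rightarrow> 'n \<Rightarrow> (bit ^ 'n \<Rightarrow> bit ^ 'n) \<Rightarrow> bool" where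
  "is_sigma_mapping i j \<tau> \<longleftrightarrow>
     (\<exists>\<sigma>. bij_betw \<sigma> (UNIV - {i}) (UNIV - {j}) \<and> \<tau> = sigma_map \<sigma> i j)"

definition ones_except :: "'n \<Rightarrow> bit ^ 'n" where
  "ones_except j = (\<chi> k. if k = j then 0 else 1)"

end

theory Submission
  imports Defs
begin

text \<open>
  Write \<open>n = 2 * m + 1\<close> and \<open>N = n + 1\<close>. A word at distance \<open>n\<close> from \<open>x\<close> is the complement
  \<open>x + 1\<close>, so \<open>\<phi>\<close> commutes with complementation, and the distances \<open>m\<close> and \<open>m + 1\<close> carry the same
  information: \<open>d(x, y) = m\<close> exactly when \<open>d(x, y + 1) = m + 1\<close>.

  The number of words at distance \<open>m\<close> from both \<open>x\<close> and \<open>y\<close> is invariant under \<open>\<phi>\<close>. There are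
  none if \<open>d(x, y)\<close> is odd, and for \<open>d(x, y) = 2 * k\<close> twice their number is \<open>c k * c (m + 1 - k)\<close>
  with \<open>c k\<close> the central binomial coefficient \<open>2 * k choose k\<close> (lemma \<open>card_common_neighbours\<close>).
  Hence \<open>\<phi>\<close> preserves the parity of distances. As \<open>c\<close> is strictly log-convex, the product determines
  \<open>k\<close> up to the exchange with \<open>m + 1 - k\<close>, so an even distance \<open>d\<close> can only become \<open>d\<close> or \<open>N - d\<close>:
  the folded distance \<open>min d (N - d)\<close> is preserved (lemma \<open>folded_dist_image\<close>).

  If \<open>m\<close> is even, an even distance \<open>2 * k \<le> m\<close> from \<open>z\<close> to \<open>y\<close> cannot become \<open>N - 2 * k\<close>: take a
  word at distance \<open>m\<close> from \<open>z\<close> and \<open>m - 2 * k\<close> from \<open>y\<close>; its image stays at distance \<open>m\<close> from the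
  image of \<open>z\<close>, and both candidates for its distance to the image of \<open>y\<close> contradict the triangle
  inequality or the bound \<open>2 * n\<close> on the perimeter of a triangle. Applied to the inverse of \<open>\<phi>\<close>, this
  also settles the larger distances.

  If \<open>m = 1\<close>, all distances are prescribed. If \<open>m \<ge> 3\<close> is odd, the middle distances are compatible
  with all symmetries of the folded distance. Add a point at infinity to the \<open>n\<close> positions
  and identify each subset of the \<open>N\<close> points with its complement. The even words of the cube are
  then exactly the classes of even subsets, and the folded distance is that of the subset cube, so all
  permutations of the \<open>N\<close> points act. The words \<open>u a\<close> of the pairs of infinity with a position \<open>a\<close>
  are mapped to pairwise intersecting pairs, which form a star with some centre \<open>J\<close>
  (lemma \<open>intersecting_pairs_star\<close>). Adding a pair to a subset of even size keeps its folded weight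
  exactly when the pair is split by the subset; here \<open>m\<close> odd is essential. Comparing the folded
  distances of \<open>x\<close> to \<open>u a\<close> and to \<open>0\<close> therefore reads off the coordinate \<open>x $ a\<close> from the image of
  \<open>x\<close> (lemma \<open>image_coordinates_if_odd\<close>). If \<open>J\<close> is infinity, \<open>\<phi>\<close> permutes the coordinates; if \<open>J\<close>
  is a position \<open>j\<close>, the position \<open>i\<close> sent to infinity and \<open>j\<close> exhibit \<open>\<phi>\<close> as a \<open>\<sigma>\<close>-mapping on the
  even words. Complementation extends this to the odd words.
\<close>

section \<open>Central binomial coefficients\<close>

lemma central_binomial_Suc:
  "(k + 1) * (2 * (k + 1) choose (k + 1)) = 2 * (2 * k + 1) * (2 * k choose k)"
proof -
  have "(2 * (k + 1) choose (k + 1)) * (k + 1) = (2 * k + 2) * ((2 * k + 1) choose k)"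
    using Suc_times_binomial_eq[of "2 * k + 1" k] by simp
  also have "((2 * k + 1) choose k) = ((2 * k + 1) choose (k + 1))"
    using binomial_symmetric[of k "2 * k + 1"] by simp
  also have "(2 * k + 2) * \<dots> = 2 * (((2 * k + 1) choose (k + 1)) * (k + 1))"
    by simp
  also have "((2 * k + 1) choose (k + 1)) * (k + 1) = (2 * k + 1) * (2 * k choose k)"
    using Suc_times_binomial_eq[of "2 * k" k] by simp
  finally show ?thesis
    by (simp add: ac_simps)
qed

lemma two_times_binomial_below_middle:
  "2 * ((2 * k + 1) choose k) = (2 * (k + 1) choose (k + 1))"
  using binomial_symmetric[of k "2 * k + 1"] by simp


text \<open>The ratio of consecutive central binomial coefficients, \<open>2 * (2 * k + 1) / (k + 1)\<close>, is
  strictly increasing in \<open>k\<close>.\<close>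
lemma central_binomial_log_convex:
  assumes "k < b"
  shows "(2 * (k + 1) choose (k + 1)) * (2 * b choose b) <
         (2 * k choose k) * (2 * (b + 1) choose (b + 1))"
proof -
  have "(2 * k + 1) * (b + 1) < (2 * b + 1) * (k + 1)"
    using assms by (simp add: algebra_simps)
  moreover have "0 < 2 * ((2 * k choose k) * (2 * b choose b))"
    by simp
  ultimately have "(2 * k + 1) * (b + 1) * (2 * ((2 * k choose k) * (2 * b choose b)))
      < (2 * b + 1) * (k + 1) * (2 * ((2 * k choose k) * (2 * b choose b)))"
    by (rule mult_strict_right_mono)
  moreover have "(2 * k + 1) * (b + 1) * (2 * ((2 * k choose k) * (2 * b choose b)))
      = (b + 1) * (2 * b choose b) * (2 * (2 * k + 1) * (2 * k choose k))"
    by (simp only: ac_simps)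
  moreover have "(2 * b + 1) * (k + 1) * (2 * ((2 * k choose k) * (2 * b choose b)))
      = (k + 1) * (2 * k choose k) * (2 * (2 * b + 1) * (2 * b choose b))"
    by (simp only: ac_simps)
  ultimately have "(b + 1) * (2 * b choose b) * ((k + 1) * (2 * (k + 1) choose (k + 1)))
      < (k + 1) * (2 * k choose k) * ((b + 1) * (2 * (b + 1) choose (b + 1)))"
    by (simp only: central_binomial_Suc)
  moreover have "(b + 1) * (2 * b choose b) * ((k + 1) * (2 * (k + 1) choose (k + 1)))
      = ((k + 1) * (b + 1)) * ((2 * (k + 1) choose (k + 1)) * (2 * b choose b))"
    by (simp only: ac_simps)
  moreover have "(k + 1) * (2 * k choose k) * ((b + 1) * (2 * (b + 1) choose (b + 1)))
      = ((k + 1) * (b + 1)) * ((2 * k choose k) * (2 * (b + 1) choose (b + 1)))"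
    by (simp only: ac_simps)
  ultimately show ?thesis
    by (metis mult_less_cancel1)
qed

lemma central_binomial_product_strict_antimono:
  assumes "k < l" "l + l \<le> s"
  shows "(2 * l choose l) * (2 * (s - l) choose (s - l)) <
         (2 * k choose k) * (2 * (s - k) choose (s - k))"
  using assms
proof (induction l)
  case (Suc l)
  have "(2 * (l + 1) choose (l + 1)) * (2 * (s - Suc l) choose (s - Suc l))
      < (2 * l choose l) * (2 * (s - Suc l + 1) choose (s - Suc l + 1))"
    using Suc.prems by (intro central_binomial_log_convex) linarith
  moreover have "s - Suc l + 1 = s - l"
    using Suc.prems by simp
  ultimately have step: "(2 * Suc l choose Suc l) * (2 * (s - Suc l) choose (s - Suc l))
      < (2 * l choose l) * (2 * (s - l) choose (s - l))"
    by (simp only: Suc_eq_plus1)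
  show ?case
  proof (cases "k = l")
    case False
    then have "k < l" "l + l \<le> s"
      using Suc.prems by simp_all
    then show ?thesis
      using Suc.IH step by (meson less_trans)
  qed (use step in simp)
qed simp

text \<open>For a fixed sum of the two arguments, the product of two central binomial coefficients
  determines the unordered pair of arguments.\<close>
lemma central_binomial_product_inj:
  assumes "k + k \<le> s" "l + l \<le> s"
    and "(2 * k choose k) * (2 * (s - k) choose (s - k)) =
         (2 * l choose l) * (2 * (s - l) choose (s - l))"
  shows "k = l"
  using central_binomial_product_strict_antimono[of k l s]
    central_binomial_product_strict_antimono[of l k s] assms
  by (metis less_irrefl linorder_neqE_nat)

section \<open>Distances in the cube\<close>

text \<open>Sending \<open>y\<close> to its set of differences from \<open>x\<close> makes \<open>x\<close> the origin: it identifies the cube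
  with the power set of the positions and distances with sizes of symmetric differences.\<close>
definition difference :: "bit ^ 'n \<Rightarrow> bit ^ 'n \<Rightarrow> 'n set" where
  "difference x y = {k. x $ k \<noteq> y $ k}"

lemma hamming_dist_eq_card_difference: "hamming_dist x y = card (difference x y)"
  by (simp add: hamming_dist_def difference_def)

lemma difference_sym_diff: "difference y z = sym_diff (difference x y) (difference x z)"
proof -
  have "y $ k \<noteq> z $ k \<longleftrightarrow> (x $ k \<noteq> y $ k) \<noteq> (x $ k \<noteq> z $ k)" for k
    by (cases "x $ k"; cases "y $ k"; cases "z $ k") simp_all
  then show ?thesis
    unfolding difference_def by blast
qed

lemma bij_betw_difference: "bij_betw (difference x) UNIV UNIV"
proof -
  let ?flip = "\<lambda>A. \<chi> k. if k \<in> A then x $ k + 1 else x $ k"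
  have "?flip (difference x y) $ k = y $ k" for y k
    by (cases "x $ k"; cases "y $ k") (simp_all add: difference_def)
  moreover have "k \<in> difference x (?flip A) \<longleftrightarrow> k \<in> A" for A k
    by (cases "x $ k") (simp_all add: difference_def)
  ultimately show ?thesis
    by (intro bij_betwI[where g = ?flip]) (simp_all only: vec_eq_iff set_eq_iff, auto)
qed

lemma finite_words: "finite (UNIV :: (bit ^ 'n) set)"
  using bij_betw_finite[OF bij_betw_difference[of 0]] by simp

lemma hamming_dist_commute: "hamming_dist x y = hamming_dist y x"
  by (simp add: hamming_dist_def eq_commute)

lemma hamming_dist_eq_0 [simp]: "hamming_dist x y = 0 \<longleftrightarrow> x = y"
  by (simp add: hamming_dist_def vec_eq_iff)

lemma hamming_dist_self [simp]: "hamming_dist x x = 0"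
  by simp

lemma hamming_dist_zero [simp]: "hamming_dist 0 x = weight x"
proof -
  have "0 $ k \<noteq> x $ k \<longleftrightarrow> x $ k \<noteq> 0" for k
    by (cases "x $ k") simp_all
  then show ?thesis
    by (simp only: hamming_dist_def weight_def)
qed

lemma hamming_dist_le: "hamming_dist (x :: bit ^ 'n) y \<le> CARD('n)"
  by (simp add: hamming_dist_def card_mono)

lemma hamming_dist_triangle: "hamming_dist x z \<le> hamming_dist x y + hamming_dist y z"
proof -
  have "card {k. x $ k \<noteq> z $ k} \<le> card ({k. x $ k \<noteq> y $ k} \<union> {k. y $ k \<noteq> z $ k})"
    by (intro card_mono) auto
  also have "\<dots> \<le> card {k. x $ k \<noteq> y $ k} + card {k. y $ k \<noteq> z $ k}"
    by (rule card_Un_le)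
  finally show ?thesis
    by (simp add: hamming_dist_def)
qed

lemma hamming_dist_plus_one:
  "hamming_dist x (y + 1) = CARD('n) - hamming_dist x y"
  for x y :: "bit ^ 'n"
proof -
  have "{k. x $ k \<noteq> (y + 1) $ k} = - {k. x $ k \<noteq> y $ k}"
  proof -
    have "x $ k \<noteq> (y + 1) $ k \<longleftrightarrow> x $ k = y $ k" for k
      by (cases "x $ k"; cases "y $ k") simp_all
    then show ?thesis
      by blast
  qed
  then show ?thesis
    by (simp only: hamming_dist_def Compl_eq_Diff_UNIV card_Diff_subset[OF finite subset_UNIV])
qed

lemma plus_one_plus_one: "x + 1 + 1 = x" for x :: "bit ^ 'n"
  by (simp add: vec_eq_iff add.assoc)

lemma hamming_dist_eq_CARD_iff: "hamming_dist x y = CARD('n) \<longleftrightarrow> y = x + 1"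
  for x y :: "bit ^ 'n"
proof -
  have "hamming_dist x y = CARD('n) \<longleftrightarrow> hamming_dist x (y + 1) = 0"
    using hamming_dist_le[of x y] by (simp only: hamming_dist_plus_one) linarith
  also have "\<dots> \<longleftrightarrow> y = x + 1"
    using plus_one_plus_one[of x] plus_one_plus_one[of y] by (simp only: hamming_dist_eq_0) metis
  finally show ?thesis .
qed

text \<open>This is the triangle inequality after replacing \<open>z\<close> by its complement: a position can separate
  at most two of the three pairs.\<close>
lemma hamming_dist_sum_le:
  "hamming_dist x y + hamming_dist y z + hamming_dist x z \<le> 2 * CARD('n)"
  for x y z :: "bit ^ 'n"
  using hamming_dist_triangle[of x y "z + 1"] hamming_dist_le[of x z] hamming_dist_le[of y z]
  by (simp add: hamming_dist_plus_one hamming_dist_commute[of "z + 1" y])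

lemma card_sym_diff:
  assumes "finite A" "finite B"
  shows "card (sym_diff A B) + 2 * card (A \<inter> B) = card A + card B"
proof -
  have "card (sym_diff A B) = card (A - B) + card (B - A)"
    using assms by (intro card_Un_disjoint) auto
  moreover have "card (A - B) + card (A \<inter> B) = card A" "card (B - A) + card (A \<inter> B) = card B"
    using card_Int_Diff[of A B] card_Int_Diff[of B A] assms by (simp_all add: Int_commute)
  ultimately show ?thesis
    by linarith
qed

lemma even_hamming_dist_triangle:
  "even (hamming_dist y z) \<longleftrightarrow> (even (hamming_dist x y) \<longleftrightarrow> even (hamming_dist x z))"
proof -
  have "hamming_dist y z + 2 * card (difference x y \<inter> difference x z)
      = hamming_dist x y + hamming_dist x z"
    unfolding hamming_dist_eq_card_difference difference_sym_diff[of y z x]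
    by (intro card_sym_diff) simp_all
  then show ?thesis
    by presburger
qed

section \<open>Counting common neighbours\<close>

text \<open>Such a set \<open>Z\<close> must contain exactly half of \<open>W\<close>, and then its part outside \<open>W\<close> is free up to
  its size.\<close>
lemma card_sets_at_distance:
  fixes W :: "'a :: finite set"
  assumes "card W = 2 * k" "k \<le> m"
  shows "card {Z. card Z = m \<and> card (sym_diff W Z) = m}
       = (2 * k choose k) * ((CARD('a) - 2 * k) choose (m - k))"
proof -
  let ?P = "{A. A \<subseteq> W \<and> card A = k} \<times> {B. B \<subseteq> - W \<and> card B = m - k}"
  have "bij_betw (\<lambda>(A, B). A \<union> B) ?P {Z. card Z = m \<and> card (sym_diff W Z) = m}"
  proof (rule bij_betwI[where g = "\<lambda>Z. (Z \<inter> W, Z - W)"])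
    show "(\<lambda>(A, B). A \<union> B) \<in> ?P \<rightarrow> {Z. card Z = m \<and> card (sym_diff W Z) = m}"
    proof
      fix p assume "p \<in> ?P"
      then obtain A B where p: "p = (A, B)"
        and AB: "A \<subseteq> W" "card A = k" "B \<subseteq> - W" "card B = m - k"
        by blast
      have "A \<inter> B = {}"
        using AB by blast
      then have "card (A \<union> B) = m"
        using AB assms by (simp add: card_Un_disjoint)
      moreover have "W \<inter> (A \<union> B) = A"
        using AB by blast
      then have "card (sym_diff W (A \<union> B)) + 2 * k = 2 * k + card (A \<union> B)"
        using card_sym_diff[of W "A \<union> B"] AB assms by (simp only: finite)
      ultimately show "(case p of (A, B) \<Rightarrow> A \<union> B) \<in> {Z. card Z = m \<and> card (sym_diff W Z) = m}"
        unfolding p by (simp only: mem_Collect_eq prod.case) linarith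
    qed
    show "(\<lambda>Z. (Z \<inter> W, Z - W)) \<in> {Z. card Z = m \<and> card (sym_diff W Z) = m} \<rightarrow> ?P"
    proof
      fix Z assume "Z \<in> {Z. card Z = m \<and> card (sym_diff W Z) = m}"
      then have Z: "card Z = m" "card (sym_diff W Z) = m"
        by (simp_all only: mem_Collect_eq)
      have "m + 2 * card (W \<inter> Z) = 2 * k + m"
        using card_sym_diff[of W Z] Z assms by (simp only: finite)
      then have "card (Z \<inter> W) = k"
        by (simp add: Int_commute)
      moreover have "card Z = card (Z \<inter> W) + card (Z - W)"
        by (rule card_Int_Diff) simp
      ultimately show "(Z \<inter> W, Z - W) \<in> ?P"
        using Z by auto
    qed
  qed auto
  then have "card {Z. card Z = m \<and> card (sym_diff W Z) = m} = card ?P"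
    by (simp add: bij_betw_same_card)
  also have "\<dots> = (2 * k choose k) * ((CARD('a) - 2 * k) choose (m - k))"
    using n_subsets[of W k] n_subsets[of "- W" "m - k"] assms
    by (simp add: card_cartesian_product Compl_eq_Diff_UNIV card_Diff_subset)
  finally show ?thesis .
qed

definition common_neighbours :: "nat \<Rightarrow> bit ^ 'n \<Rightarrow> bit ^ 'n \<Rightarrow> (bit ^ 'n) set" where
  "common_neighbours m x y = {z. hamming_dist x z = m \<and> hamming_dist y z = m}"

lemma even_hamming_dist_if_common_neighbour:
  "z \<in> common_neighbours m x y \<Longrightarrow> even (hamming_dist x y)"
  using even_hamming_dist_triangle[of x y z]
  by (simp add: common_neighbours_def hamming_dist_commute)

text \<open>The two factors are symmetric under \<open>k \<mapsto> m + 1 - k\<close>. This symmetry is what leaves the ambiguity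
  between the distances \<open>d\<close> and \<open>n + 1 - d\<close>.\<close>
lemma card_common_neighbours:
  fixes x y :: "bit ^ 'n"
  assumes "CARD('n) = 2 * m + 1" "hamming_dist x y = 2 * k"
  shows "2 * card (common_neighbours m x y)
       = (2 * k choose k) * (2 * (m + 1 - k) choose (m + 1 - k))"
proof -
  have k: "k \<le> m"
    using hamming_dist_le[of x y] assms by simp
  let ?W = "difference x y"
  have *: "hamming_dist x z = card (difference x z) \<and>
      hamming_dist y z = card (sym_diff ?W (difference x z))" for z
    using difference_sym_diff[of y z x] by (simp only: hamming_dist_eq_card_difference)
  have "bij_betw (difference x) (common_neighbours m x y)
      {Z. card Z = m \<and> card (sym_diff ?W Z) = m}"
    unfolding bij_betw_def
  proof
    show "inj_on (difference x) (common_neighbours m x y)"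
      using bij_betw_difference[of x] by (auto simp: bij_betw_def intro: inj_on_subset)
    have image: "difference x ` {z. Q (difference x z)} = {Z. Q Z}" for Q
      using surj_image_vimage_eq[of "difference x" "Collect Q"] bij_betw_difference[of x]
      by (simp add: bij_betw_def vimage_def)
    show "difference x ` common_neighbours m x y
        = {Z. card Z = m \<and> card (sym_diff ?W Z) = m}"
      using image[of "\<lambda>Z. card Z = m \<and> card (sym_diff ?W Z) = m"]
      by (simp only: common_neighbours_def *)
  qed
  then have "card (common_neighbours m x y)
      = (2 * k choose k) * ((CARD('n) - 2 * k) choose (m - k))"
    using card_sets_at_distance[of ?W k m] assms k
    by (simp only: bij_betw_same_card hamming_dist_eq_card_difference)
  also have "CARD('n) - 2 * k = 2 * (m - k) + 1"
    using assms k by simp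
  finally show ?thesis
    using two_times_binomial_below_middle[of "m - k"] k by (simp add: Suc_diff_le)
qed

section \<open>The folded distance\<close>

text \<open>This is the distance after extending both words by a zero in one further position and
  identifying complementary words of the larger cube. Hence the summand \<open>1\<close>.\<close>
definition folded_dist :: "bit ^ 'n \<Rightarrow> bit ^ 'n \<Rightarrow> nat" where
  "folded_dist x y = min (hamming_dist x y) (CARD('n) + 1 - hamming_dist x y)"

lemma folded_dist_cases:
  fixes x y u v :: "bit ^ 'n"
  assumes "folded_dist x y = folded_dist u v"
  shows "hamming_dist x y = hamming_dist u v \<or> hamming_dist x y = CARD('n) + 1 - hamming_dist u v"
  using assms hamming_dist_le[of x y] hamming_dist_le[of u v]
  by (simp add: folded_dist_def min_def split: if_splits)

text \<open>Of the two possible values \<open>k\<close> and \<open>m + 1 - k\<close>, half of the folded distance is the smaller one,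
  which lies in the range where the product of central binomial coefficients is injective.\<close>
lemma card_common_neighbours_folded:
  fixes x y :: "bit ^ 'n"
  assumes "CARD('n) = 2 * m + 1" "even (hamming_dist x y)"
  obtains h where "folded_dist x y = 2 * h" "h + h \<le> m + 1"
    "2 * card (common_neighbours m x y) = (2 * h choose h) * (2 * (m + 1 - h) choose (m + 1 - h))"
proof -
  obtain k where k: "hamming_dist x y = 2 * k"
    using assms by blast
  then have "k \<le> m"
    using hamming_dist_le[of x y] assms by simp
  have count: "2 * card (common_neighbours m x y)
      = (2 * k choose k) * (2 * (m + 1 - k) choose (m + 1 - k))"
    by (rule card_common_neighbours[OF assms(1) k])
  show ?thesis
  proof (cases "k + k \<le> m + 1")
    case True
    show ?thesis
      by (rule that[OF _ True count]) (use True k assms in \<open>simp add: folded_dist_def\<close>)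
  next
    case False
    have "m + 1 - (m + 1 - k) = k"
      using \<open>k \<le> m\<close> by simp
    then show ?thesis
      using that[of "m + 1 - k"] False k assms count
      by (simp add: folded_dist_def mult.commute)
  qed
qed

lemma folded_dist_eq_if_card_common_neighbours_eq:
  fixes x y u v :: "bit ^ 'n"
  assumes "CARD('n) = 2 * m + 1" "even (hamming_dist x y)" "even (hamming_dist u v)"
    and "card (common_neighbours m x y) = card (common_neighbours m u v)"
  shows "folded_dist x y = folded_dist u v"
proof -
  obtain h where h: "folded_dist x y = 2 * h" "h + h \<le> m + 1"
    "2 * card (common_neighbours m x y) = (2 * h choose h) * (2 * (m + 1 - h) choose (m + 1 - h))"
    by (rule card_common_neighbours_folded[OF assms(1,2)])
  obtain l where l: "folded_dist u v = 2 * l" "l + l \<le> m + 1"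
    "2 * card (common_neighbours m u v) = (2 * l choose l) * (2 * (m + 1 - l) choose (m + 1 - l))"
    by (rule card_common_neighbours_folded[OF assms(1,3)])
  show ?thesis
    using central_binomial_product_inj[OF h(2) l(2)] h l assms(4) by metis
qed

section \<open>Bijections preserving the middle distances\<close>

text \<open>The properties that are needed of a bijection preserving \<open>m\<close>, \<open>m + 1\<close> and \<open>n = 2 * m + 1\<close>. In
  this form they are inherited by the inverse.\<close>
locale central_isometry =
  fixes \<phi> :: "bit ^ 'n \<Rightarrow> bit ^ 'n" and m :: nat
  assumes card_positions: "CARD('n) = 2 * m + 1"
    and bij: "bij \<phi>"
    and dist_m: "hamming_dist x y = m \<Longrightarrow> hamming_dist (\<phi> x) (\<phi> y) = m"
    and plus_one: "\<phi> (x + 1) = \<phi> x + 1"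
begin

lemma inj_eq_iff: "\<phi> x = \<phi> y \<longleftrightarrow> x = y"
  using bij by (meson bij_def injD)

text \<open>The pairs of words at distance \<open>m\<close> form a finite set that is mapped injectively to itself,
  hence onto itself.\<close>
lemma dist_m_iff: "hamming_dist (\<phi> x) (\<phi> y) = m \<longleftrightarrow> hamming_dist x y = m"
proof
  let ?S = "{(x, y). hamming_dist x y = m} :: ((bit ^ 'n) \<times> (bit ^ 'n)) set"
  assume "hamming_dist (\<phi> x) (\<phi> y) = m"
  have "map_prod \<phi> \<phi> ` ?S = ?S"
  proof (rule endo_inj_surj)
    show "finite ?S"
      by (rule finite_subset[OF subset_UNIV]) (simp add: finite_words finite_prod)
    show "map_prod \<phi> \<phi> ` ?S \<subseteq> ?S"
      using dist_m by auto
    show "inj_on (map_prod \<phi> \<phi>) ?S"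
      using bij by (blast intro: inj_on_subset prod.inj_map bij_is_inj)
  qed
  moreover have "(\<phi> x, \<phi> y) \<in> ?S"
    using \<open>hamming_dist (\<phi> x) (\<phi> y) = m\<close> by simp
  ultimately have "(\<phi> x, \<phi> y) \<in> map_prod \<phi> \<phi> ` ?S"
    by simp
  then show "hamming_dist x y = m"
    by (auto simp: inj_eq_iff)
qed (rule dist_m)

lemma apply_inv: "\<phi> (inv \<phi> x) = x"
  using bij by (simp add: bij_is_surj surj_f_inv_f)

lemma inverse_central_isometry: "central_isometry (inv \<phi>) m"
proof
  show "CARD('n) = 2 * m + 1"
    by (rule card_positions)
  show "bij (inv \<phi>)"
    using bij by (rule bij_imp_bij_inv)
  show "hamming_dist (inv \<phi> x) (inv \<phi> y) = m" if "hamming_dist x y = m" for x y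
    using dist_m_iff[of "inv \<phi> x" "inv \<phi> y"] that by (simp add: apply_inv)
  show "inv \<phi> (x + 1) = inv \<phi> x + 1" for x
    using inj_eq_iff[of "inv \<phi> (x + 1)" "inv \<phi> x + 1"] by (simp add: apply_inv plus_one)
qed

text \<open>A distance is even if and only if the two words have a common neighbour at distance \<open>m\<close>.\<close>
lemma even_dist_image:
  assumes "even (hamming_dist x y)"
  shows "even (hamming_dist (\<phi> x) (\<phi> y))"
proof -
  obtain k where "hamming_dist x y = 2 * k"
    using assms by blast
  then have "2 * card (common_neighbours m x y) \<noteq> 0"
    by (subst card_common_neighbours[OF card_positions]) simp_all
  then obtain z where "z \<in> common_neighbours m x y"
    by fastforce
  then have "\<phi> z \<in> common_neighbours m (\<phi> x) (\<phi> y)"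
    using dist_m by (simp add: common_neighbours_def)
  then show ?thesis
    by (rule even_hamming_dist_if_common_neighbour)
qed

text \<open>Common neighbours are mapped onto common neighbours, and their number determines the folded
  distance.\<close>
lemma folded_dist_image:
  assumes "even (hamming_dist x y)"
  shows "folded_dist (\<phi> x) (\<phi> y) = folded_dist x y"
proof -
  have "\<phi> ` common_neighbours m x y = common_neighbours m (\<phi> x) (\<phi> y)"
  proof
    show "\<phi> ` common_neighbours m x y \<subseteq> common_neighbours m (\<phi> x) (\<phi> y)"
      using dist_m by (auto simp: common_neighbours_def)
    show "common_neighbours m (\<phi> x) (\<phi> y) \<subseteq> \<phi> ` common_neighbours m x y"
    proof
      fix z assume "z \<in> common_neighbours m (\<phi> x) (\<phi> y)"
      then have "inv \<phi> z \<in> common_neighbours m x y"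
        using dist_m_iff[of _ "inv \<phi> z"] by (simp add: common_neighbours_def apply_inv)
      then show "z \<in> \<phi> ` common_neighbours m x y"
        by (metis image_eqI apply_inv)
    qed
  qed
  then have "card (common_neighbours m (\<phi> x) (\<phi> y)) = card (common_neighbours m x y)"
    using card_image[of \<phi> "common_neighbours m x y"] bij
    by (metis bij_is_inj inj_on_subset subset_UNIV)
  then show ?thesis
    using folded_dist_eq_if_card_common_neighbours_eq card_positions assms even_dist_image by blast
qed

text \<open>Since the dimension is odd, complementing one of two words at odd distance makes the distance
  even.\<close>
lemma cube_isometry_if_even_dist_preserved:
  assumes "\<And>x y. even (hamming_dist x y) \<Longrightarrow> hamming_dist (\<phi> x) (\<phi> y) = hamming_dist x y"
  shows "cube_isometry \<phi>"
proof -
  have "hamming_dist (\<phi> x) (\<phi> y) = hamming_dist x y" for x y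
  proof (cases "even (hamming_dist x y)")
    case False
    then have "even (hamming_dist x (y + 1))"
      using hamming_dist_le[of x y] card_positions by (simp add: hamming_dist_plus_one)
    then have "hamming_dist (\<phi> x) (\<phi> y + 1) = hamming_dist x (y + 1)"
      using assms plus_one by metis
    then show ?thesis
      using hamming_dist_le[of x y] hamming_dist_le[of "\<phi> x" "\<phi> y"]
      by (simp add: hamming_dist_plus_one)
  qed (rule assms)
  then show ?thesis
    using bij by (simp add: cube_isometry_def)
qed

text \<open>The only alternative to \<open>2 * k\<close> is \<open>2 * m + 2 - 2 * k\<close>. A word \<open>x\<close> that lies at distance \<open>m\<close>
  from \<open>z\<close> on a geodesic through \<open>y\<close> excludes it. The parity of \<open>m\<close> matters because the distance
  \<open>m - 2 * k\<close> from \<open>x\<close> to \<open>y\<close> must be even for its image to be controlled.\<close>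
lemma dist_le_m_preserved:
  assumes "even m" "hamming_dist z y = 2 * k" "2 * k \<le> m"
  shows "hamming_dist (\<phi> z) (\<phi> y) = 2 * k"
proof (rule ccontr)
  assume "hamming_dist (\<phi> z) (\<phi> y) \<noteq> 2 * k"
  moreover have "folded_dist (\<phi> z) (\<phi> y) = folded_dist z y"
    using assms by (intro folded_dist_image) simp
  ultimately have zy: "hamming_dist (\<phi> z) (\<phi> y) = 2 * m + 2 - 2 * k"
    using folded_dist_cases[of "\<phi> z" "\<phi> y" z y] assms card_positions by simp
  let ?D = "difference z y"
  obtain B where B: "?D \<subseteq> B" "card B = m"
    using exists_subset_between[of ?D m UNIV] assms card_positions
    by (auto simp: hamming_dist_eq_card_difference)
  obtain x where x: "difference z x = B"
    using bij_betw_difference[of z] by (metis bij_pointE)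
  have zx: "hamming_dist (\<phi> z) (\<phi> x) = m"
    using B x by (intro dist_m) (simp add: hamming_dist_eq_card_difference)
  have "sym_diff B ?D = B - ?D"
    using B by blast
  then have xy: "hamming_dist x y = m - 2 * k"
    using B x assms difference_sym_diff[of x y z]
    by (simp add: hamming_dist_eq_card_difference card_Diff_subset)
  then have "folded_dist (\<phi> x) (\<phi> y) = folded_dist x y"
    using assms by (intro folded_dist_image) simp
  then consider "hamming_dist (\<phi> x) (\<phi> y) = m - 2 * k"
    | "hamming_dist (\<phi> x) (\<phi> y) = 2 * m + 2 - (m - 2 * k)"
    using folded_dist_cases[of "\<phi> x" "\<phi> y" x y] xy card_positions by fastforce
  then show False
  proof cases
    case 1
    then show ?thesis
      using hamming_dist_triangle[of "\<phi> z" "\<phi> y" "\<phi> x"] zx zy assms by simp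
  next
    case 2
    then show ?thesis
      using hamming_dist_sum_le[of "\<phi> z" "\<phi> x" "\<phi> y"] zx zy assms card_positions by simp
  qed
qed

text \<open>A distance above \<open>m\<close> that is not preserved becomes one of at most \<open>m\<close>, which the inverse
  would have to preserve.\<close>
lemma cube_isometry_if_even:
  assumes "even m"
  shows "cube_isometry \<phi>"
proof (rule cube_isometry_if_even_dist_preserved)
  fix x y :: "bit ^ 'n" assume ev: "even (hamming_dist x y)"
  show "hamming_dist (\<phi> x) (\<phi> y) = hamming_dist x y"
  proof (cases "hamming_dist x y \<le> m")
    case True
    then show ?thesis
      using dist_le_m_preserved[OF assms] ev by (metis evenE)
  next
    case False
    show ?thesis
    proof (rule ccontr)
      assume "hamming_dist (\<phi> x) (\<phi> y) \<noteq> hamming_dist x y"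
      then have image: "hamming_dist (\<phi> x) (\<phi> y) = 2 * m + 2 - hamming_dist x y"
        using folded_dist_cases[OF folded_dist_image[OF ev]] card_positions by simp
      then have "hamming_dist (\<phi> x) (\<phi> y) \<le> m"
        using False ev assms by presburger
      moreover interpret inverse: central_isometry "inv \<phi>" m
        by (rule inverse_central_isometry)
      obtain k where "hamming_dist (\<phi> x) (\<phi> y) = 2 * k"
        using even_dist_image[OF ev] by blast
      ultimately have "hamming_dist (inv \<phi> (\<phi> x)) (inv \<phi> (\<phi> y)) = hamming_dist (\<phi> x) (\<phi> y)"
        using inverse.dist_le_m_preserved[OF assms] by simp
      then have "hamming_dist x y = hamming_dist (\<phi> x) (\<phi> y)"
        using bij by (simp add: bij_is_inj)
      then show False
        using \<open>hamming_dist (\<phi> x) (\<phi> y) \<noteq> hamming_dist x y\<close> by simp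
    qed
  qed
qed

end

section \<open>Words as subsets of the positions and one further point\<close>

text \<open>The point \<^term>\<open>None\<close> is the position at infinity. A set containing it is replaced by its
  complement, and the resulting set of positions is read as a word.\<close>
definition folded_word :: "'n option set \<Rightarrow> bit ^ 'n" where
  "folded_word S = (\<chi> k. of_bool ((Some k \<in> S) \<noteq> (None \<in> S)))"

text \<open>Of the two sets that \<^const>\<open>folded_word\<close> maps to \<open>x\<close>, this is the one without \<^term>\<open>None\<close>.\<close>
definition support :: "bit ^ 'n \<Rightarrow> 'n option set" where
  "support x = Some ` {k. x $ k = 1}"

lemma Some_in_support_iff [simp]: "Some k \<in> support x \<longleftrightarrow> x $ k = 1"
  by (auto simp: support_def)

lemma None_notin_support [simp]: "None \<notin> support x"
  by (auto simp: support_def)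

lemma card_support: "card (support x) = weight x"
  by (simp add: support_def weight_def card_image)

lemma folded_word_support [simp]: "folded_word (support x) = x"
proof -
  have "of_bool (x $ k = 1) = x $ k" for k
    by (cases "x $ k") simp_all
  then show ?thesis
    by (simp add: folded_word_def vec_eq_iff)
qed

lemma folded_word_Compl: "folded_word (- S) = folded_word S"
  by (simp add: folded_word_def vec_eq_iff)

lemma folded_word_empty [simp]: "folded_word {} = 0"
  by (simp add: folded_word_def vec_eq_iff)

lemma card_Some_mem_neq_None_mem:
  fixes U :: "'a :: finite option set"
  shows "card {k. (Some k \<in> U) \<noteq> (None \<in> U)} =
    (if None \<in> U then CARD('a) + 1 - card U else card U)"
proof -
  have "card {k. (Some k \<in> U) \<noteq> (None \<in> U)} = card (Some ` {k. (Some k \<in> U) \<noteq> (None \<in> U)})"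
    by (simp add: card_image)
  also have "Some ` {k. (Some k \<in> U) \<noteq> (None \<in> U)} = (if None \<in> U then UNIV - U else U)"
    by (auto simp: image_iff) (metis not_None_eq)+
  also have "card \<dots> = (if None \<in> U then CARD('a) + 1 - card U else card U)"
    by (simp add: card_Diff_subset card_UNIV_option)
  finally show ?thesis .
qed

lemma hamming_dist_folded_word:
  fixes S T :: "'n :: finite option set"
  defines "U \<equiv> sym_diff S T"
  shows "hamming_dist (folded_word S) (folded_word T) =
    (if None \<in> U then CARD('n) + 1 - card U else card U)"
proof -
  have "{k. folded_word S $ k \<noteq> folded_word T $ k} = {k. (Some k \<in> U) \<noteq> (None \<in> U)}"
    unfolding U_def by (auto simp: folded_word_def)
  then show ?thesis
    by (simp only: hamming_dist_def card_Some_mem_neq_None_mem)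
qed

lemma folded_dist_folded_word:
  fixes S T :: "'n :: finite option set"
  shows "folded_dist (folded_word S) (folded_word T) =
    min (card (sym_diff S T)) (CARD('n) + 1 - card (sym_diff S T))"
proof -
  have "card (sym_diff S T) \<le> CARD('n) + 1"
    using card_mono[of "UNIV :: 'n option set" "sym_diff S T"] by (simp add: card_UNIV_option)
  then show ?thesis
    unfolding folded_dist_def hamming_dist_folded_word by (simp add: min.commute)
qed

lemma obtain_folded_word_of_card:
  fixes x :: "bit ^ 'n"
  assumes "folded_dist x 0 = d"
  obtains S where "x = folded_word S" "card S = d"
proof (cases "weight x = d")
  case True
  then show ?thesis
    using that[of "support x"] by (simp add: card_support)
next
  case False
  have "weight x \<le> CARD('n)"
    using hamming_dist_le[of 0 x] by simp
  then have "card (- support x) = d"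
    using False assms
    by (simp add: folded_dist_def hamming_dist_commute[of x] Compl_eq_Diff_UNIV card_Diff_subset
        card_UNIV_option card_support min_def split: if_splits)
  then show ?thesis
    using that[of "- support x"] by (simp add: folded_word_Compl)
qed

text \<open>Adding a pair to a set changes its size by \<open>0\<close> or by \<open>\<pm>2\<close>, the former exactly when the set
  splits the pair. A change by \<open>\<pm>2\<close> is visible in the folded distance unless it exchanges the sizes
  \<open>m\<close> and \<open>m + 2\<close>, which are odd here.\<close>
lemma folded_dist_pair_eq_iff:
  fixes x :: "bit ^ 'n"
  assumes "CARD('n) = 2 * m + 1" "odd m" "even (weight x)" "J \<noteq> K"
  shows "folded_dist x (folded_word {J, K}) = folded_dist x 0 \<longleftrightarrow>
    (J \<in> support x) \<noteq> (K \<in> support x)"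
proof -
  let ?T = "support x"
  let ?U = "sym_diff ?T {J, K}"
  have U: "card ?U + 2 * card (?T \<inter> {J, K}) = card ?T + 2"
    using card_sym_diff[of ?T "{J, K}"] assms by simp
  have le: "card ?T \<le> 2 * m + 1"
    using hamming_dist_le[of 0 x] assms by (simp add: card_support)
  have "card ?U \<le> 2 * m + 2"
    using card_mono[of "UNIV :: 'n option set" ?U] assms by (simp add: card_UNIV_option)
  moreover have "folded_dist x (folded_word {J, K}) = min (card ?U) (2 * m + 2 - card ?U)"
    using folded_dist_folded_word[of ?T "{J, K}"] assms(1) by simp
  moreover have "folded_dist x 0 = min (card ?T) (2 * m + 2 - card ?T)"
    using folded_dist_folded_word[of ?T "{}"] assms(1) by simp
  ultimately have eq_iff: "folded_dist x (folded_word {J, K}) = folded_dist x 0 \<longleftrightarrow>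
      card ?U = card ?T \<or> card ?U + card ?T = 2 * m + 2"
    using le by (simp add: min_def) linarith
  have "card ?T \<noteq> m" "card ?T \<noteq> m + 2"
    using assms(2,3) by (auto simp: card_support)
  moreover consider "J \<in> ?T" "K \<in> ?T" "?T \<inter> {J, K} = {J, K}"
    | "J \<in> ?T" "K \<notin> ?T" "?T \<inter> {J, K} = {J}"
    | "J \<notin> ?T" "K \<in> ?T" "?T \<inter> {J, K} = {K}"
    | "J \<notin> ?T" "K \<notin> ?T" "?T \<inter> {J, K} = {}"
    by blast
  then have "card ?U = card ?T \<and> (J \<in> ?T) \<noteq> (K \<in> ?T) \<or>
      card ?U = card ?T + 2 \<and> (J \<in> ?T) = (K \<in> ?T) \<or>
      card ?U + 2 = card ?T \<and> (J \<in> ?T) = (K \<in> ?T)"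
    using U \<open>J \<noteq> K\<close> by cases simp_all
  ultimately show ?thesis
    unfolding eq_iff by (elim disjE conjE) linarith+
qed

text \<open>Pairwise intersecting pairs form a star or lie in a triangle, and a triangle has only three
  pairs.\<close>
lemma intersecting_pairs_star:
  fixes S :: "'a :: finite \<Rightarrow> 'b set"
  assumes "inj S" "\<And>a. card (S a) = 2" "\<And>a b. S a \<inter> S b \<noteq> {}" "CARD('a) \<ge> 4"
  obtains J where "\<And>a. J \<in> S a"
proof (rule ccontr)
  assume "\<not> thesis"
  then have no_centre: "\<exists>a. J \<notin> S a" for J
    using that by blast
  have pair: "S a = {K, L}" if "K \<in> S a" "L \<in> S a" "K \<noteq> L" for K L a
  proof -
    have "finite (S a)"
      using assms(2)[of a] by (metis card.infinite zero_neq_numeral)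
    then have "{K, L} = S a"
      using that assms(2)[of a] by (intro card_subset_eq) simp_all
    then show ?thesis
      by (rule sym)
  qed
  have meets: "K \<in> S b \<or> L \<in> S b" if "S a = {K, L}" for a b K L
    using assms(3)[of a b] unfolding that by blast
  have other: "\<exists>d. d \<notin> A" if "card A < CARD('a)" for A :: "'a set"
    using that by (metis UNIV_eq_I less_irrefl)
  obtain a b :: 'a where "b \<noteq> a"
    using other[of "{undefined}"] assms(4) by auto
  obtain J where J: "J \<in> S a" "J \<in> S b"
    using assms(3)[of a b] by blast
  obtain K where K: "K \<in> S a" "K \<noteq> J"
    using assms(2)[of a] by (metis card_2_iff')
  obtain L where L: "L \<in> S b" "L \<noteq> J"
    using assms(2)[of b] by (metis card_2_iff')
  have Sa: "S a = {J, K}" and Sb: "S b = {J, L}"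
    using pair J K L by simp_all
  then have "K \<noteq> L"
    using assms(1) \<open>b \<noteq> a\<close> by (metis injD)
  obtain c where "J \<notin> S c"
    using no_centre by blast
  then have Sc: "S c = {K, L}"
    using meets[OF Sa, of c] meets[OF Sb, of c] \<open>K \<noteq> L\<close> by (intro pair) simp_all
  have "card {a, b, c} \<le> 3"
    by (simp add: card_insert_if)
  then obtain d where d: "d \<notin> {a, b, c}"
    using other[of "{a, b, c}"] assms(4) by auto
  then have "S d \<noteq> {J, K}" "S d \<noteq> {J, L}" "S d \<noteq> {K, L}"
    unfolding Sa[symmetric] Sb[symmetric] Sc[symmetric] by (simp_all add: inj_eq[OF assms(1)])
  then show False
    using meets[OF Sa, of d] meets[OF Sb, of d] meets[OF Sc, of d] pair[of J d K] pair[of J d L]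
      pair[of K d L] K(2) L(2) \<open>K \<noteq> L\<close> by blast
qed

section \<open>The case of an odd middle distance\<close>

context central_isometry
begin

text \<open>The words of the pairs \<open>{None, Some a}\<close> have folded distance \<open>2\<close> from \<open>0\<close> and from each other.
  Their images are words of pairs again. Disjoint pairs give words at folded distance
  \<open>min 4 (2 * m - 2)\<close>, which is not \<open>2\<close> as \<open>m \<ge> 3\<close>; so the image pairs intersect and
  share a point \<open>J\<close>. By \<open>folded_dist_pair_eq_iff\<close>, a coordinate \<open>x $ a\<close> says whether
  \<open>x\<close> has the same folded distance from \<open>0\<close> and from the word of \<open>{None, Some a}\<close>, and this
  condition can be evaluated on the image of \<open>x\<close> instead.\<close>
lemma image_coordinates_if_odd:
  assumes "odd m" "m \<noteq> 1" "\<phi> 0 = 0"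
  obtains J p where "bij_betw p UNIV (UNIV - {J})"
    "\<And>x a. even (weight x) \<Longrightarrow> x $ a = 1 \<longleftrightarrow> (J \<in> support (\<phi> x)) \<noteq> (p a \<in> support (\<phi> x))"
proof -
  have "m \<ge> 3"
    using assms by presburger
  let ?u = "\<lambda>a. folded_word {None, Some a} :: bit ^ 'n"
  have u0: "hamming_dist (?u a) 0 = 2 * m" for a
    using hamming_dist_folded_word[of "{None, Some a}" "{}"] card_positions by simp
  have uu: "hamming_dist (?u a) (?u b) = 2" if "a \<noteq> b" for a b
  proof -
    have "sym_diff {None, Some a} {None, Some b} = {Some a, Some b}"
      using that by auto
    then show ?thesis
      using hamming_dist_folded_word[of "{None, Some a}" "{None, Some b}"] that by simp
  qed
  have "\<exists>S. \<phi> (?u a) = folded_word S \<and> card S = 2" for a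
  proof -
    have "folded_dist (\<phi> (?u a)) 0 = 2"
      using folded_dist_image[of "?u a" 0] u0[of a] card_positions \<open>m \<ge> 3\<close> assms(3)
      by (simp add: folded_dist_def)
    then show ?thesis
      using obtain_folded_word_of_card by metis
  qed
  then obtain S where S: "\<And>a. \<phi> (?u a) = folded_word (S a)" "\<And>a. card (S a) = 2"
    by metis
  have "inj S"
  proof (rule injI, rule ccontr)
    fix a b assume "S a = S b" "a \<noteq> b"
    then have "?u a = ?u b"
      using S(1) inj_eq_iff by metis
    then show False
      using uu[OF \<open>a \<noteq> b\<close>] by simp
  qed
  have "S a \<inter> S b \<noteq> {}" for a b
  proof (cases "a = b")
    case True
    then show ?thesis
      using S(2)[of b] by auto
  next
    case False
    show ?thesis
    proof
      assume "S a \<inter> S b = {}"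
      then have "card (sym_diff (S a) (S b)) = 4"
        using card_sym_diff[of "S a" "S b"] S(2) by simp
      then have "folded_dist (\<phi> (?u a)) (\<phi> (?u b)) \<noteq> 2"
        using folded_dist_folded_word[of "S a" "S b"] S(1) card_positions \<open>m \<ge> 3\<close> by simp
      then show False
        using folded_dist_image[of "?u a" "?u b"] uu[OF False] card_positions \<open>m \<ge> 3\<close>
        by (simp add: folded_dist_def)
    qed
  qed
  then obtain J where J: "\<And>a. J \<in> S a"
    using intersecting_pairs_star[of S] \<open>inj S\<close> S(2) card_positions \<open>m \<ge> 3\<close> by auto
  have "\<exists>K. S a = {J, K} \<and> J \<noteq> K" for a
    using S(2)[of a] J[of a] by (auto simp: card_2_iff)
  then obtain p where p: "\<And>a. S a = {J, p a}" "\<And>a. J \<noteq> p a"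
    by metis
  have "inj p"
    using \<open>inj S\<close> p(1) by (metis (no_types, lifting) injD injI)
  \<comment> \<open>There are as many positions as points other than \<open>J\<close>.\<close>
  moreover have "range p = UNIV - {J}"
  proof (rule card_subset_eq)
    show "range p \<subseteq> UNIV - {J}"
      using p(2) by blast
    show "card (range p) = card (UNIV - {J})"
      using \<open>inj p\<close> by (simp add: card_image card_UNIV_option)
  qed simp
  ultimately have "bij_betw p UNIV (UNIV - {J})"
    by (simp add: bij_betw_def)
  moreover have "x $ a = 1 \<longleftrightarrow> (J \<in> support (\<phi> x)) \<noteq> (p a \<in> support (\<phi> x))"
    if "even (weight x)" for x a
  proof -
    have x0: "even (hamming_dist x 0)"
      using that by (simp add: hamming_dist_commute[of x])
    have "even (weight (\<phi> x))"
      using even_dist_image[OF x0] assms(3) by (simp add: hamming_dist_commute[of _ 0])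
    have "even (hamming_dist x (?u a))"
      using even_hamming_dist_triangle[of x "?u a" 0] that u0[of a]
      by (simp add: hamming_dist_commute[of _ 0])
    then have "folded_dist (\<phi> x) (folded_word {J, p a}) = folded_dist x (?u a)"
      using folded_dist_image S(1) p(1) by metis
    moreover have "folded_dist (\<phi> x) 0 = folded_dist x 0"
      using folded_dist_image[OF x0] assms(3) by simp
    moreover have "folded_dist x (?u a) = folded_dist x 0 \<longleftrightarrow> x $ a = 1"
      using folded_dist_pair_eq_iff[OF card_positions assms(1) that, of None "Some a"] by simp
    moreover have "folded_dist (\<phi> x) (folded_word {J, p a}) = folded_dist (\<phi> x) 0 \<longleftrightarrow>
        (J \<in> support (\<phi> x)) \<noteq> (p a \<in> support (\<phi> x))"
      using \<open>even (weight (\<phi> x))\<close> p(2)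
      by (rule folded_dist_pair_eq_iff[OF card_positions assms(1)])
    ultimately show ?thesis
      by simp
  qed
  ultimately show ?thesis
    by (rule that)
qed

lemma even_weight_plus_one: "even (weight (x + 1)) \<longleftrightarrow> odd (weight x)" for x :: "bit ^ 'n"
  using hamming_dist_plus_one[of 0 x] hamming_dist_le[of 0 x] card_positions by simp

lemma cube_isometry_if_permutes_coordinates:
  assumes "bij q" "\<And>x a. even (weight x) \<Longrightarrow> \<phi> x $ q a = x $ a"
  shows "cube_isometry \<phi>"
proof -
  have all: "\<phi> x $ q a = x $ a" for x a
  proof (cases "even (weight x)")
    case False
    then have "\<phi> (x + 1) $ q a = (x + 1) $ a"
      by (intro assms(2)) (simp add: even_weight_plus_one)
    then show ?thesis
      by (simp only: plus_one vector_add_component one_index add_right_cancel)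
  qed (rule assms(2))
  have "difference (\<phi> x) (\<phi> y) = q ` difference x y" for x y
  proof -
    have "q ` difference x y = q ` (q -` difference (\<phi> x) (\<phi> y))"
      using all by (simp add: difference_def)
    then show ?thesis
      using assms(1) by (simp add: surj_image_vimage_eq bij_is_surj)
  qed
  moreover have "inj_on q A" for A
    using assms(1) by (meson bij_is_inj inj_on_subset subset_UNIV)
  ultimately show ?thesis
    using bij by (simp add: cube_isometry_def hamming_dist_eq_card_difference card_image)
qed

end

section \<open>Recognising \<open>\<sigma>\<close>-mappings\<close>

lemma bit_eqI: "(x = 1 \<longleftrightarrow> y = 1) \<Longrightarrow> x = y" for x y :: bit
  by (cases x; cases y) simp_all

lemma bit_eq_add_iff: "z = x + y \<longleftrightarrow> (x = 1 \<longleftrightarrow> (y = 1) \<noteq> (z = 1))" for x y z :: bit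
  by (cases x; cases y; cases z) simp_all

text \<open>Complementing the argument of a \<open>\<sigma>\<close>-mapping changes only the entry \<open>j\<close> of its value. Hence
  a map that commutes with complementation and is a \<open>\<sigma>\<close>-mapping on the even words carries the
  additional translation on the odd words.\<close>
lemma sigma_map_plus_one:
  "sigma_map \<sigma> i j (c + 1) + 1 = translation (ones_except j) (sigma_map \<sigma> i j c)"
proof -
  have "(sigma_map \<sigma> i j (c + 1) + 1) $ k = translation (ones_except j) (sigma_map \<sigma> i j c) $ k" for k
    by (cases "c $ i"; cases "c $ inv_into (UNIV - {i}) \<sigma> k")
      (simp_all add: sigma_map_def translation_def ones_except_def)
  then show ?thesis
    by (simp add: vec_eq_iff)
qed

lemma sigma_map_eqI:
  assumes "bij_betw \<sigma> (UNIV - {i}) (UNIV - {j})"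
    and "y $ j = c $ i" "\<And>a. a \<noteq> i \<Longrightarrow> y $ \<sigma> a = c $ a + c $ i"
  shows "y = sigma_map \<sigma> i j c"
proof -
  have "y $ k = sigma_map \<sigma> i j c $ k" for k
  proof (cases "k = j")
    case True
    then show ?thesis
      using assms(2) by (cases "c $ i") (simp_all add: sigma_map_def)
  next
    case False
    let ?a = "inv_into (UNIV - {i}) \<sigma> k"
    have "k \<in> \<sigma> ` (UNIV - {i})"
      using False assms(1) by (simp add: bij_betw_def)
    then have "?a \<in> UNIV - {i}" "\<sigma> ?a = k"
      by (rule inv_into_into, rule f_inv_into_f)
    then show ?thesis
      using assms(3)[of ?a] False by (cases "c $ i") (simp_all add: sigma_map_def)
  qed
  then show ?thesis
    by (simp add: vec_eq_iff)
qed

text \<open>Here \<open>J\<close> is the centre of the star. If it is \<^term>\<open>None\<close>, then \<open>\<phi>\<close> permutes coordinates, and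
  otherwise \<open>J = Some j\<close>, and \<open>i\<close> is the position whose pair \<open>{None, Some i}\<close> is mapped to
  \<open>{None, Some j}\<close>. For \<open>m = 1\<close> all non-zero even distances are \<open>2\<close>, so nothing is left to prove.\<close>
lemma (in central_isometry) sigma_map_on_even_words_if_odd:
  assumes "odd m" "\<phi> 0 = 0" "\<not> cube_isometry \<phi>"
  obtains i j \<sigma> where "bij_betw \<sigma> (UNIV - {i}) (UNIV - {j})"
    "\<And>c. even (weight c) \<Longrightarrow> \<phi> c = sigma_map \<sigma> i j c"
proof -
  \<comment> \<open>In dimension 3, intersecting pairs on four points may form a triangle, so this case is separate.
    The only candidate for the image of the distance \<open>2\<close> is then \<open>4 - 2\<close>.\<close>
  have "m \<noteq> 1"
  proof
    assume "m = 1"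
    have "cube_isometry \<phi>"
    proof (rule cube_isometry_if_even_dist_preserved)
      fix x y :: "bit ^ 'n" assume ev: "even (hamming_dist x y)"
      show "hamming_dist (\<phi> x) (\<phi> y) = hamming_dist x y"
      proof (cases "x = y")
        case False
        then have "hamming_dist x y \<noteq> 0"
          by simp
        then have "hamming_dist x y = 2"
          using ev hamming_dist_le[of x y] card_positions \<open>m = 1\<close> by presburger
        then show ?thesis
          using folded_dist_cases[OF folded_dist_image[OF ev]] card_positions \<open>m = 1\<close> by simp
      qed simp
    qed
    then show False
      using assms(3) by simp
  qed
  then obtain J p where p: "bij_betw p UNIV (UNIV - {J})"
    and \<phi>_iff: "\<And>x a. even (weight x) \<Longrightarrow>
      x $ a = 1 \<longleftrightarrow> (J \<in> support (\<phi> x)) \<noteq> (p a \<in> support (\<phi> x))"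
    using image_coordinates_if_odd assms(1,2) by metis
  have "inj p" and range: "range p = UNIV - {J}"
    using p unfolding bij_betw_def by simp_all
  have "J \<noteq> None"
  proof
    assume "J = None"
    then have p': "p a \<noteq> None" for a
      using rangeI[of p a, unfolded range] by simp
    have "bij (the \<circ> p)"
    proof (rule bij_betw_trans[OF p])
      show "bij_betw the (UNIV - {J}) UNIV"
        using \<open>J = None\<close> by (intro bij_betwI[where g = Some]) auto
    qed
    moreover have "\<phi> x $ (the \<circ> p) a = x $ a" if "even (weight x)" for x a
    proof -
      have "Some (the (p a)) = p a"
        using p' by simp
      then have "\<phi> x $ the (p a) = 1 \<longleftrightarrow> x $ a = 1"
        using \<phi>_iff[OF that, of a] Some_in_support_iff[of "the (p a)" "\<phi> x"] \<open>J = None\<close> by simp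
      then show ?thesis
        unfolding o_apply by (rule bit_eqI)
    qed
    ultimately show False
      using cube_isometry_if_permutes_coordinates assms(3) by blast
  qed
  then obtain j where j: "J = Some j"
    by blast
  have "None \<in> range p"
    using range j by simp
  then obtain i where i: "p i = None"
    by (metis rangeE)
  let ?\<sigma> = "the \<circ> p"
  have p_other: "p a = Some (?\<sigma> a)" if "a \<noteq> i" for a
  proof -
    have "p a \<noteq> None"
      using \<open>inj p\<close> i that by (metis injD)
    then show ?thesis
      by simp
  qed
  have "bij_betw ?\<sigma> (UNIV - {i}) (UNIV - {j})"
  proof (rule bij_betw_trans)
    have "p ` (UNIV - {i}) = (UNIV - {J}) - {None}"
      using image_set_diff[OF \<open>inj p\<close>, of UNIV "{i}"] range i by simp
    also have "\<dots> = Some ` (UNIV - {j})"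
    proof (rule set_eqI)
      show "q \<in> (UNIV - {J}) - {None} \<longleftrightarrow> q \<in> Some ` (UNIV - {j})" for q
        using j by (cases q) auto
    qed
    finally show "bij_betw p (UNIV - {i}) (Some ` (UNIV - {j}))"
      using inj_on_subset[OF \<open>inj p\<close> subset_UNIV] by (simp add: bij_betw_def)
    show "bij_betw the (Some ` (UNIV - {j})) (UNIV - {j})"
      by (intro bij_betwI[where g = Some]) auto
  qed
  moreover have "\<phi> c = sigma_map ?\<sigma> i j c" if "even (weight c)" for c
  proof (rule sigma_map_eqI[OF calculation])
    have "c $ i = 1 \<longleftrightarrow> \<phi> c $ j = 1"
      using \<phi>_iff[OF that, of i] unfolding i j by simp
    then show j_entry: "\<phi> c $ j = c $ i"
      by (intro bit_eqI) simp
    show "\<phi> c $ ?\<sigma> a = c $ a + c $ i" if "a \<noteq> i" for a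
    proof -
      have "c $ a = 1 \<longleftrightarrow> (\<phi> c $ j = 1) \<noteq> (\<phi> c $ ?\<sigma> a = 1)"
        using \<phi>_iff[OF \<open>even (weight c)\<close>, of a] unfolding j p_other[OF that] Some_in_support_iff .
      then show ?thesis
        by (simp only: j_entry bit_eq_add_iff)
    qed
  qed
  ultimately show ?thesis
    by (rule that)
qed

lemma central_isometry_if_P_isometry:
  fixes \<phi> :: "bit ^ 'n \<Rightarrow> bit ^ 'n"
  assumes "CARD('n) = 2 * m + 1" "P_isometry P \<phi>" "m \<in> P" "CARD('n) \<in> P"
  shows "central_isometry \<phi> m"
proof
  show "\<phi> (x + 1) = \<phi> x + 1" for x
  proof -
    have "hamming_dist (\<phi> x) (\<phi> (x + 1)) = CARD('n)"
      using assms(2,4) hamming_dist_eq_CARD_iff[of x "x + 1"] by (simp add: P_isometry_def)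
    then show ?thesis
      by (simp only: hamming_dist_eq_CARD_iff)
  qed
qed (use assms in \<open>auto simp: P_isometry_def\<close>)

theorem theorem8:
  fixes n :: nat and \<phi> :: "bit ^ 'n \<Rightarrow> bit ^ 'n"
  assumes "n = CARD('n)"
    and "odd n"
    and "P_isometry {(n - 1) div 2, (n + 1) div 2, n} \<phi>"
    and "\<phi> 0 = 0"
  shows "(n mod 4 = 1 \<longrightarrow> cube_isometry \<phi>) \<and>
    (n mod 4 = 3 \<and> \<not> cube_isometry \<phi> \<longrightarrow>
      (\<exists>i j \<tau>. is_sigma_mapping i j \<tau> \<and>
        (\<forall>c\<in>even_words. \<phi> c = \<tau> c) \<and>
        (\<forall>c\<in>odd_words. \<phi> c = (translation (ones_except j) \<circ> \<tau>) c)))"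
proof -
  define m where "m = (n - 1) div 2"
  have n: "n = 2 * m + 1"
    using \<open>odd n\<close> unfolding m_def by presburger
  interpret central_isometry \<phi> m
  proof (rule central_isometry_if_P_isometry[OF _ assms(3)])
    show "CARD('n) = 2 * m + 1"
      using assms(1) n by simp
  qed (simp_all add: m_def assms(1))
  show ?thesis
  proof (intro conjI impI)
    assume "n mod 4 = 1"
    then have "even m"
      using n by presburger
    then show "cube_isometry \<phi>"
      by (rule cube_isometry_if_even)
  next
    assume asm: "n mod 4 = 3 \<and> \<not> cube_isometry \<phi>"
    then have "n mod 4 = 3"
      by blast
    then have "odd m"
      using n by presburger
    then obtain i j \<sigma> where \<sigma>: "bij_betw \<sigma> (UNIV - {i}) (UNIV - {j})"
      and \<phi>_even: "\<And>c. even (weight c) \<Longrightarrow> \<phi> c = sigma_map \<sigma> i j c"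
      using sigma_map_on_even_words_if_odd[OF _ assms(4)] asm by metis
    have "\<phi> c = translation (ones_except j) (sigma_map \<sigma> i j c)" if "odd (weight c)" for c
    proof -
      have "\<phi> (c + 1) = sigma_map \<sigma> i j (c + 1)"
        by (rule \<phi>_even) (simp add: even_weight_plus_one that)
      moreover have "\<phi> c = \<phi> (c + 1) + 1"
        by (simp only: plus_one plus_one_plus_one)
      ultimately show ?thesis
        by (simp only: sigma_map_plus_one)
    qed
    then show "\<exists>i j \<tau>. is_sigma_mapping i j \<tau> \<and> (\<forall>c\<in>even_words. \<phi> c = \<tau> c) \<and>
        (\<forall>c\<in>odd_words. \<phi> c = (translation (ones_except j) \<circ> \<tau>) c)"
      using \<sigma> \<phi>_even
      by (intro exI[of _ i] exI[of _ j] exI[of _ "sigma_map \<sigma> i j"])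
        (auto simp: is_sigma_mapping_def even_words_def odd_words_def)
  qed
qed

end
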